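(* Let $T$ be a rooted tree. For every ideal $J$ of the commutative BCK-algebra $\mathbf{A}^T$ we have $J=I(\mathcal{P}(J))$. In particular, every ideal of $\mathbf{A}^T$ has the form $I(R)$ for some collection $R$ of root-based paths in $T$.
   Context: A commutative BCK-algebra is an algebra $\mathbf{A}=\langle A;\cdot,0\rangle$ of type $(2,0)$ such that for all $x,y,z\in A$: $(x\cdot y)\cdot z=(x\cdot z)\cdot y$; $x\cdot(x\cdot y)=y\cdot(y\cdot x)$; $x\cdot x=0$; $x\cdot 0=x$. An ideal is a subset $I\subseteq A$ with $0\in I$ such that $x\cdot y\in I$ and $y\in I$ imply $x\in I$. Let $T$ be a (possibly infinite) rooted tree with root $\lambda$ and vertex set $V(T)$, ordered by $\alpha\le_T\beta$ iff $\alpha$ is $\beta$ or an ancestor of $\beta$. A root-based path is a finite or infinite path in $T$ starting at $\lambda$ and moving away from the root (it contains at least $\lambda$); $\mathbb{P}(T)$ is the set of all root-based paths, and $[\lambda,\alpha]$ is the path from $\lambda$ to $\alpha$. For $\mathbf{u}\colon V(T)\to\mathbb{Z}$ write $u_\alpha$ for its value at $\alpha$ and $\mathbf{u}_p$ for the tuple of values of $\mathbf{u}$ along the path $p$; $\mathbf{0}$ is the zero function. The set $A^T$ consists of all $\mathbf{u}\colon V(T)\to\mathbb{Z}$ with finitely many non-zero values such that along every root-based path the first non-zero value (if any) is positive. With $\le_\ell$ the lexicographic order on tuples, define $$(\mathbf{u}\cdot\mathbf{v})_\alpha=\begin{cases}u_\alpha-v_\alpha&\text{if }\mathbf{u}_{[\lambda,\alpha]}>_\ell\mathbf{v}_{[\lambda,\alpha]},\\0&\text{if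 }\mathbf{u}_{[\lambda,\alpha]}\le_\ell\mathbf{v}_{[\lambda,\alpha]}.\end{cases}$$ Then $\mathbf{A}^T=\langle A^T;\cdot,\mathbf{0}\rangle$ is a commutative BCK-algebra. For $U\subseteq A^T$ put $\mathcal{P}(U)=\{p\in\mathbb{P}(T)\mid\mathbf{u}_p=\mathbf{0}_p\text{ for all }\mathbf{u}\in U\}$, and for $R\subseteq\mathbb{P}(T)$ put $I(R)=\{\mathbf{u}\in A^T\mid\mathbf{u}_p=\mathbf{0}_p\text{ for all }p\in R\}$ (so $I(\varnothing)=A^T$). *)

theory Defs
  imports Main
begin

section \<open>Rooted trees\<close>

record 'v rooted_graph =
  verts :: "'v set"
  edges :: "'v set set"
  rt :: 'v

definition is_path :: "'v rooted_graph \<Rightarrow> 'v list \<Rightarrow> bool" where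
  "is_path T xs \<longleftrightarrow> xs \<noteq> [] \<and> set xs \<subseteq> verts T \<and> distinct xs
     \<and> successively (\<lambda>x y. {x, y} \<in> edges T) xs"

definition is_cycle :: "'v rooted_graph \<Rightarrow> 'v list \<Rightarrow> bool" where
  "is_cycle T xs \<longleftrightarrow> is_path T xs \<and> length xs \<ge> 3 \<and> {last xs, hd xs} \<in> edges T"

text \<open>Connected acyclic simple graphs with a distinguished vertex.  The vertex set and the
  degrees may be infinite.\<close>

definition rooted_tree :: "'v rooted_graph \<Rightarrow> bool" where
  "rooted_tree T \<longleftrightarrow>
     (\<forall>e\<in>edges T. \<exists>x\<in>verts T. \<exists>y\<in>verts T. x \<noteq> y \<and> e = {x, y})
     \<and> rt T \<in> verts T
     \<and> (\<forall>x\<in>verts T. \<forall>y\<in>verts T. \<exists>xs. is_path T xs \<and> hd xs = x \<and> last xs = y)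
     \<and> (\<nexists>xs. is_cycle T xs)"

text \<open>The path $[\lambda,\alpha]$, meaningful for vertices of a rooted tree, where it exists and
  is unique.\<close>

definition path_to :: "'v rooted_graph \<Rightarrow> 'v \<Rightarrow> 'v list" where
  "path_to T \<alpha> = (THE xs. is_path T xs \<and> hd xs = rt T \<and> last xs = \<alpha>)"

definition tree_le :: "'v rooted_graph \<Rightarrow> 'v \<Rightarrow> 'v \<Rightarrow> bool" where
  "tree_le T \<alpha> \<beta> \<longleftrightarrow> \<alpha> \<in> verts T \<and> \<beta> \<in> verts T \<and> \<alpha> \<in> set (path_to T \<beta>)"

definition step_away :: "'v rooted_graph \<Rightarrow> 'v \<Rightarrow> 'v \<Rightarrow> bool" where
  "step_away T \<alpha> \<beta> \<longleftrightarrow> {\<alpha>, \<beta>} \<in> edges T \<and> \<alpha> \<noteq> \<beta> \<and> tree_le T \<alpha> \<beta>"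


section \<open>Root-based paths and tuples along them\<close>

text \<open>Finite or infinite sequences.  They serve both as paths and as the tuples of
  values along paths: the tuple $\mathbf{u}_p$ is \<open>map_seq u p\<close>.\<close>

datatype (set_seq: 'a) seq = Fin "'a list" | Inf "nat \<Rightarrow> 'a"
  for map: map_seq

fun root_based :: "'v rooted_graph \<Rightarrow> 'v seq \<Rightarrow> bool" where
  "root_based T (Fin xs) \<longleftrightarrow> xs \<noteq> [] \<and> hd xs = rt T \<and> successively (step_away T) xs"
| "root_based T (Inf f) \<longleftrightarrow> f 0 = rt T \<and> (\<forall>i. step_away T (f i) (f (Suc i)))"

definition root_based_paths :: "'v rooted_graph \<Rightarrow> 'v seq set" where
  "root_based_paths T = {p. root_based T p}"

fun first_nonzero_pos :: "int seq \<Rightarrow> bool" where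
  "first_nonzero_pos (Fin xs) \<longleftrightarrow>
     (\<forall>i<length xs. xs ! i \<noteq> 0 \<and> (\<forall>j<i. xs ! j = 0) \<longrightarrow> xs ! i > 0)"
| "first_nonzero_pos (Inf f) \<longleftrightarrow>
     (\<forall>i. f i \<noteq> 0 \<and> (\<forall>j<i. f j = 0) \<longrightarrow> f i > 0)"

definition lex_less :: "int list \<Rightarrow> int list \<Rightarrow> bool" where
  "lex_less xs ys \<longleftrightarrow> (xs, ys) \<in> lexord {(a, b). a < b}"


section \<open>Ideals and the algebra of a rooted tree\<close>

record 'a bck =
  carrier :: "'a set"
  bck_op :: "'a \<Rightarrow> 'a \<Rightarrow> 'a"
  bck_zero :: 'a

definition comm_bck_algebra :: "'a bck \<Rightarrow> bool" where
  "comm_bck_algebra A \<longleftrightarrow>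
     bck_zero A \<in> carrier A
     \<and> (\<forall>x\<in>carrier A. \<forall>y\<in>carrier A. bck_op A x y \<in> carrier A)
     \<and> (\<forall>x\<in>carrier A. \<forall>y\<in>carrier A. \<forall>z\<in>carrier A.
          bck_op A (bck_op A x y) z = bck_op A (bck_op A x z) y)
     \<and> (\<forall>x\<in>carrier A. \<forall>y\<in>carrier A.
          bck_op A x (bck_op A x y) = bck_op A y (bck_op A y x))
     \<and> (\<forall>x\<in>carrier A. bck_op A x x = bck_zero A)
     \<and> (\<forall>x\<in>carrier A. bck_op A x (bck_zero A) = x)"

definition bck_ideal :: "'a bck \<Rightarrow> 'a set \<Rightarrow> bool" where
  "bck_ideal A I \<longleftrightarrow> I \<subseteq> carrier A \<and> bck_zero A \<in> I
     \<and> (\<forall>x\<in>carrier A. \<forall>y\<in>carrier A. bck_op A x y \<in> I \<and> y \<in> I \<longrightarrow> x \<in> I)"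

text \<open>A function $V(T) \to \mathbb{Z}$ is represented by its extension by zero to the
  whole type, so that equality of functions is equality on $V(T)$.\<close>

definition tree_carrier :: "'v rooted_graph \<Rightarrow> ('v \<Rightarrow> int) set" where
  "tree_carrier T = {u. (\<forall>\<alpha>. \<alpha> \<notin> verts T \<longrightarrow> u \<alpha> = 0)
     \<and> finite {\<alpha> \<in> verts T. u \<alpha> \<noteq> 0}
     \<and> (\<forall>p\<in>root_based_paths T. first_nonzero_pos (map_seq u p))}"

definition tree_op :: "'v rooted_graph \<Rightarrow> ('v \<Rightarrow> int) \<Rightarrow> ('v \<Rightarrow> int) \<Rightarrow> 'v \<Rightarrow> int" where
  "tree_op T u v = (\<lambda>\<alpha>.
     if \<alpha> \<in> verts T \<and> lex_less (map v (path_to T \<alpha>)) (map u (path_to T \<alpha>))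
     then u \<alpha> - v \<alpha> else 0)"

definition tree_algebra :: "'v rooted_graph \<Rightarrow> ('v \<Rightarrow> int) bck" where
  "tree_algebra T = \<lparr>carrier = tree_carrier T, bck_op = tree_op T, bck_zero = (\<lambda>_. 0)\<rparr>"

definition zero_paths :: "'v rooted_graph \<Rightarrow> ('v \<Rightarrow> int) set \<Rightarrow> 'v seq set" where
  "zero_paths T U = {p \<in> root_based_paths T. \<forall>u\<in>U. map_seq u p = map_seq (\<lambda>_. 0) p}"

definition vanishing_on :: "'v rooted_graph \<Rightarrow> 'v seq set \<Rightarrow> ('v \<Rightarrow> int) set" where
  "vanishing_on T R =
     {u \<in> carrier (tree_algebra T). \<forall>p\<in>R. map_seq u p = map_seq (\<lambda>_. 0) p}"


section \<open>The algebra of a rooted tree is a commutative BCK-algebra\<close>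

lemma rooted_tree_no_cycle: "rooted_tree T \<Longrightarrow> \<not> is_cycle T xs"
  by (auto simp: rooted_tree_def)

lemma is_path_rev: "is_path T (rev xs) \<longleftrightarrow> is_path T xs"
  by (simp add: is_path_def insert_commute)

lemma is_path_append: "is_path T (xs @ ys) \<Longrightarrow> xs \<noteq> [] \<Longrightarrow> is_path T xs"
  by (auto simp: is_path_def successively_append_iff)

lemma is_path_join:
  "is_path T (xs @ [z]) \<Longrightarrow> is_path T (z # ys) \<Longrightarrow> set xs \<inter> set ys = {} \<Longrightarrow> is_path T (xs @ z # ys)"
  by (auto simp: is_path_def successively_append_iff)

lemma path_unique:
  assumes T: "rooted_tree T" and "is_path T xs" "is_path T ys" "hd xs = hd ys" "last xs = last ys"
  shows "xs = ys"
  using assms(2-)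
proof (induction xs arbitrary: ys)
  case Nil
  then show ?case by (simp add: is_path_def)
next
  case (Cons a xs)
  then obtain ys' where ys: "ys = a # ys'"
    by (cases ys) (auto simp: is_path_def)
  show ?case
  proof (cases "xs = [] \<or> ys' = []")
    case True
    have "set xs = {}" if "ys' = []"
      using Cons.prems that last_in_set[of xs] unfolding ys is_path_def by (cases "xs = []") auto
    moreover have "set ys' = {}" if "xs = []"
      using Cons.prems that last_in_set[of ys'] unfolding ys is_path_def by (cases "ys' = []") auto
    ultimately show ?thesis using True ys by auto
  next
    case False
    then have lst: "last xs = last ys'" and p: "is_path T xs" "is_path T ys'"
      using Cons.prems by (auto simp: ys is_path_def successively_Cons)
    show ?thesis
    proof (cases "hd xs = hd ys'")
      case True
      then show ?thesis using Cons.IH[OF p _ lst] ys by simp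
    next
      case neq: False
      have "\<exists>z\<in>set xs. z \<in> set ys'" using lst False by (metis last_in_set)
      then obtain p z q where xs: "xs = p @ z # q" and z: "z \<in> set ys'"
        and pd: "\<forall>w\<in>set p. w \<notin> set ys'"
        using split_list_first_prop[of xs "\<lambda>z. z \<in> set ys'"] by blast
      obtain r s where ys': "ys' = r @ z # s" using z by (meson split_list)
      have e: "{hd ys', a} \<in> edges T"
        using Cons.prems(2) False by (cases ys') (auto simp: ys is_path_def insert_commute)
      have p1: "is_path T ((a # p) @ [z])"
        using is_path_append[of T "(a # p) @ [z]" q] Cons.prems(1) by (simp add: xs)
      have "is_path T (r @ [z])"
        using is_path_append[of T "r @ [z]" s] p(2) by (simp add: ys')
      then have p2: "is_path T (z # rev r)"
        using is_path_rev[of T "r @ [z]"] by simp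
      have "is_path T ((a # p) @ z # rev r)"
      proof (rule is_path_join[OF p1 p2])
        show "set (a # p) \<inter> set (rev r) = {}"
          using pd Cons.prems(2) by (auto simp: is_path_def ys ys')
      qed
      moreover have "length ((a # p) @ z # rev r) \<ge> 3"
        using neq by (cases p; cases r) (auto simp: xs ys')
      moreover have "last ((a # p) @ z # rev r) = hd ys'"
        by (cases r) (auto simp: ys')
      ultimately have "is_cycle T ((a # p) @ z # rev r)"
        using e by (simp add: is_cycle_def)
      then show ?thesis using rooted_tree_no_cycle[OF T] by blast
    qed
  qed
qed

lemma path_to_eqI:
  assumes "rooted_tree T" "is_path T xs" "hd xs = rt T"
  shows "path_to T (last xs) = xs"
  unfolding path_to_def using assms path_unique[OF assms(1)] by (intro the_equality) auto

lemma path_to: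
  assumes "rooted_tree T" "\<alpha> \<in> verts T"
  shows "is_path T (path_to T \<alpha>)" "hd (path_to T \<alpha>) = rt T" "last (path_to T \<alpha>) = \<alpha>"
proof -
  obtain xs where "is_path T xs" "hd xs = rt T" "last xs = \<alpha>"
    using assms unfolding rooted_tree_def by blast
  with path_to_eqI[OF assms(1), of xs]
  show "is_path T (path_to T \<alpha>)" "hd (path_to T \<alpha>) = rt T" "last (path_to T \<alpha>) = \<alpha>" by auto
qed

lemma path_to_nonempty: "rooted_tree T \<Longrightarrow> \<alpha> \<in> verts T \<Longrightarrow> path_to T \<alpha> \<noteq> []"
  by (drule (1) path_to(1)) (simp add: is_path_def)

lemma path_to_prefix:
  assumes T: "rooted_tree T" and a: "\<alpha> \<in> verts T" and eq: "path_to T \<alpha> = xs @ x # ys"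
  shows "path_to T x = xs @ [x]" "x \<in> verts T"
proof -
  have "is_path T (xs @ [x])"
    using is_path_append[of T "xs @ [x]" ys] path_to(1)[OF T a] eq by simp
  moreover have "hd (xs @ [x]) = rt T"
    using path_to(2)[OF T a] eq by (cases xs) auto
  ultimately show "path_to T x = xs @ [x]"
    using path_to_eqI[OF T, of "xs @ [x]"] by simp
  show "x \<in> verts T" using path_to(1)[OF T a] eq by (auto simp: is_path_def)
qed

lemma path_to_nth:
  assumes T: "rooted_tree T" and a: "\<alpha> \<in> verts T" and i: "i < length (path_to T \<alpha>)"
  shows "path_to T (path_to T \<alpha> ! i) = take (Suc i) (path_to T \<alpha>)" "path_to T \<alpha> ! i \<in> verts T"
  using path_to_prefix[OF T a id_take_nth_drop[OF i]] i
  by (auto simp: take_Suc_conv_app_nth)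

lemma root_based_Fin_path_to:
  assumes T: "rooted_tree T"
  shows "root_based T (Fin xs) \<Longrightarrow> last xs \<in> verts T \<and> path_to T (last xs) = xs"
proof (induction xs rule: rev_induct)
  case Nil
  then show ?case by simp
next
  case (snoc y xs)
  show ?case
  proof (cases "xs = []")
    case True
    have "rt T \<in> verts T" using T by (simp add: rooted_tree_def)
    then show ?thesis using snoc.prems True path_to_eqI[OF T, of "[rt T]"] by (simp add: is_path_def)
  next
    case False
    let ?x = "last xs"
    from snoc.prems False have "root_based T (Fin xs)" and st: "step_away T ?x y"
      by (auto simp: successively_append_iff)
    with snoc.IH have x: "?x \<in> verts T" "path_to T ?x = xs" by auto
    from st have y: "y \<in> verts T" "?x \<in> set (path_to T y)" "?x \<noteq> y" "{?x, y} \<in> edges T"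
      by (auto simp: step_away_def tree_le_def)
    then obtain P Q where PQ: "path_to T y = P @ ?x # Q" by (meson split_list)
    have xs: "xs = P @ [?x]" using path_to_prefix(1)[OF T y(1) PQ] unfolding x(2) .
    have ly: "last (?x # Q) = y" using path_to(3)[OF T y(1)] unfolding PQ by simp
    with y(3) have "Q \<noteq> []" by (cases Q) simp_all
    with ly have "y \<in> set Q" using last_in_set[of Q] by simp
    moreover have "distinct (P @ ?x # Q)"
      using path_to(1)[OF T y(1)] unfolding PQ is_path_def by blast
    ultimately have "y \<notin> set (P @ [?x])" by auto
    then have "y \<notin> set xs" unfolding xs[symmetric] .
    then have "is_path T (xs @ [y])"
      using path_to(1)[OF T x(1)] x(2) y by (auto simp: is_path_def successively_append_iff)
    then show ?thesis using path_to_eqI[OF T, of "xs @ [y]"] y(1) snoc.prems by simp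
  qed
qed

lemma root_based_path_to:
  assumes T: "rooted_tree T" and a: "\<alpha> \<in> verts T"
  shows "root_based T (Fin (path_to T \<alpha>))"
proof -
  let ?P = "path_to T \<alpha>"
  have "step_away T (?P ! i) (?P ! Suc i)" if i: "Suc i < length ?P" for i
  proof -
    have P: "is_path T ?P" by (rule path_to(1)[OF T a])
    have "?P ! i \<in> set (take (Suc (Suc i)) ?P)"
      using i by (auto simp: in_set_conv_nth intro!: exI[of _ i])
    moreover have "{?P ! i, ?P ! Suc i} \<in> edges T" "?P ! i \<noteq> ?P ! Suc i"
      using P i by (auto simp: is_path_def successively_conv_nth nth_eq_iff_index_eq)
    ultimately show ?thesis
      using path_to_nth[OF T a i] path_to_nth(2)[OF T a, of i] i
      by (auto simp: step_away_def tree_le_def)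
  qed
  then show ?thesis
    using path_to_nonempty[OF T a] path_to(2)[OF T a] by (simp add: successively_conv_nth)
qed

definition lex_pos :: "nat \<Rightarrow> (nat \<Rightarrow> int) \<Rightarrow> bool" where
  "lex_pos n f \<longleftrightarrow> (\<exists>k<n. f k > 0 \<and> (\<forall>j<k. f j = 0))"

lemma lex_pos_trichotomy: "lex_pos n f \<or> lex_pos n (\<lambda>i. - f i) \<or> (\<forall>i<n. f i = 0)"
proof (cases "\<forall>i<n. f i = 0")
  case False
  define k where "k = (LEAST k. f k \<noteq> 0)"
  from False obtain i where i: "i < n" "f i \<noteq> 0" by auto
  have "f k \<noteq> 0" "k \<le> i" using i LeastI[of "\<lambda>k. f k \<noteq> 0" i] Least_le[of "\<lambda>k. f k \<noteq> 0" i]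
    by (auto simp: k_def)
  moreover have "\<forall>j<k. f j = 0" using not_less_Least k_def by blast
  ultimately show ?thesis using i unfolding lex_pos_def
    by (cases "f k > 0") (auto intro!: exI[of _ k])
qed auto

lemma lex_pos_add:
  assumes "lex_pos n f" "lex_pos n g \<or> (\<forall>i<n. g i = 0)"
  shows "lex_pos n (\<lambda>i. f i + g i)"
proof -
  from assms(1) obtain k where k: "k < n" "f k > 0" "\<forall>j<k. f j = 0" by (auto simp: lex_pos_def)
  from assms(2) show ?thesis
  proof
    assume "lex_pos n g"
    then obtain l where l: "l < n" "g l > 0" "\<forall>j<l. g j = 0" by (auto simp: lex_pos_def)
    have "f (min k l) + g (min k l) > 0" using k l
      by (cases k l rule: linorder_cases) (auto simp: min_def)
    then show ?thesis unfolding lex_pos_def using k l by (intro exI[of _ "min k l"]) auto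
  next
    assume "\<forall>i<n. g i = 0"
    then show ?thesis unfolding lex_pos_def using k by (intro exI[of _ k]) auto
  qed
qed

lemma lex_pos_zero: "\<forall>i<n. f i = 0 \<Longrightarrow> \<not> lex_pos n f"
  by (auto simp: lex_pos_def)

lemma lex_pos_cong: "(\<And>i. i < n \<Longrightarrow> f i = g i) \<Longrightarrow> lex_pos n f = lex_pos n g"
  unfolding lex_pos_def by (metis order_less_trans)

lemma lex_less_map_iff:
  "lex_less (map v xs) (map u xs) \<longleftrightarrow> lex_pos (length xs) (\<lambda>i. u (xs ! i) - v (xs ! i))"
proof (induction xs)
  case Nil
  then show ?case by (simp add: lex_less_def lex_pos_def)
next
  case (Cons x xs)
  have "lex_pos (Suc n) f \<longleftrightarrow> f 0 > 0 \<or> f 0 = 0 \<and> lex_pos n (\<lambda>i. f (Suc i))" for n f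
    unfolding lex_pos_def Ex_less_Suc2 All_less_Suc2 by auto
  with Cons show ?case by (auto simp: lex_less_def)
qed

lemma tree_op_along:
  assumes T: "rooted_tree T" and a: "\<alpha> \<in> verts T" and i: "i < length (path_to T \<alpha>)"
  shows "tree_op T u v (path_to T \<alpha> ! i) =
    (if lex_pos (length (path_to T \<alpha>)) (\<lambda>j. u (path_to T \<alpha> ! j) - v (path_to T \<alpha> ! j))
     then u (path_to T \<alpha> ! i) - v (path_to T \<alpha> ! i) else 0)"
proof -
  let ?P = "path_to T \<alpha>"
  let ?f = "\<lambda>j. u (?P ! j) - v (?P ! j)"
  have "lex_less (map v (take (Suc i) ?P)) (map u (take (Suc i) ?P)) \<longleftrightarrow> lex_pos (Suc i) ?f"
  proof -
    have len: "length (take (Suc i) ?P) = Suc i" using i by simp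
    show ?thesis unfolding lex_less_map_iff len by (rule lex_pos_cong) simp
  qed
  moreover have "?f i = 0" if "lex_pos (length ?P) ?f" "\<not> lex_pos (Suc i) ?f"
    using that i unfolding lex_pos_def by (metis less_Suc_eq not_less_eq)
  moreover have "lex_pos (length ?P) ?f" if "lex_pos (Suc i) ?f"
    using that i unfolding lex_pos_def by (metis Suc_leI order_less_le_trans)
  ultimately show ?thesis
    unfolding tree_op_def using path_to_nth[OF T a i] by auto
qed

lemma tree_carrier_iff:
  assumes T: "rooted_tree T"
  shows "u \<in> tree_carrier T \<longleftrightarrow> (\<forall>\<alpha>. \<alpha> \<notin> verts T \<longrightarrow> u \<alpha> = 0) \<and> finite {\<alpha> \<in> verts T. u \<alpha> \<noteq> 0}
     \<and> (\<forall>\<alpha>\<in>verts T. lex_pos (length (path_to T \<alpha>)) (\<lambda>i. u (path_to T \<alpha> ! i))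
           \<or> (\<forall>i<length (path_to T \<alpha>). u (path_to T \<alpha> ! i) = 0))"
    (is "_ \<longleftrightarrow> _ \<and> _ \<and> ?R")
proof -
  have Fin: "first_nonzero_pos (Fin (map u xs)) \<longleftrightarrow>
     lex_pos (length xs) (\<lambda>i. u (xs ! i)) \<or> (\<forall>i<length xs. u (xs ! i) = 0)" for xs
  proof
    assume *: "first_nonzero_pos (Fin (map u xs))"
    have "\<not> lex_pos (length xs) (\<lambda>i. - u (xs ! i))"
    proof
      assume "lex_pos (length xs) (\<lambda>i. - u (xs ! i))"
      then obtain k where "k < length xs" "u (xs ! k) < 0" "\<forall>j<k. u (xs ! j) = 0"
        by (auto simp: lex_pos_def)
      with * show False by force
    qed
    with lex_pos_trichotomy[of "length xs" "\<lambda>i. u (xs ! i)"]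
    show "lex_pos (length xs) (\<lambda>i. u (xs ! i)) \<or> (\<forall>i<length xs. u (xs ! i) = 0)" by auto
  next
    assume *: "lex_pos (length xs) (\<lambda>i. u (xs ! i)) \<or> (\<forall>i<length xs. u (xs ! i) = 0)"
    have "u (xs ! i) > 0" if i: "i < length xs" "u (xs ! i) \<noteq> 0" "\<forall>j<i. u (xs ! j) = 0" for i
    proof -
      from * i obtain k where "k < length xs" "u (xs ! k) > 0" "\<forall>j<k. u (xs ! j) = 0"
        by (auto simp: lex_pos_def)
      moreover from this i have "k = i" by (metis linorder_cases less_irrefl)
      ultimately show ?thesis by simp
    qed
    then show "first_nonzero_pos (Fin (map u xs))" by auto
  qed
  have "(\<forall>p\<in>root_based_paths T. first_nonzero_pos (map_seq u p)) \<longleftrightarrow> ?R"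
  proof
    assume R: "\<forall>p\<in>root_based_paths T. first_nonzero_pos (map_seq u p)"
    show ?R
    proof
      fix \<alpha> assume "\<alpha> \<in> verts T"
      then have "Fin (path_to T \<alpha>) \<in> root_based_paths T"
        unfolding root_based_paths_def using root_based_path_to[OF T] by blast
      with R have "first_nonzero_pos (map_seq u (Fin (path_to T \<alpha>)))" by blast
      then show "lex_pos (length (path_to T \<alpha>)) (\<lambda>i. u (path_to T \<alpha> ! i))
           \<or> (\<forall>i<length (path_to T \<alpha>). u (path_to T \<alpha> ! i) = 0)"
        unfolding seq.map Fin .
    qed
  next
    assume R: ?R
    have fin: "first_nonzero_pos (Fin (map u xs))" if "root_based T (Fin xs)" for xs
      using R root_based_Fin_path_to[OF T that] Fin by metis
    have "first_nonzero_pos (Inf (\<lambda>i. u (f i)))" if f: "root_based T (Inf f)" for f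
    proof -
      have "u (f i) > 0" if i: "u (f i) \<noteq> 0" "\<forall>j<i. u (f j) = 0" for i
      proof -
        have hd0: "hd (map f [0..<Suc i]) = f 0"
          by (simp add: upt_conv_Cons del: upt_Suc)
        have "root_based T (Fin (map f [0..<Suc i]))"
          using f hd0 by (simp add: successively_conv_nth del: upt_Suc)
        from fin[OF this] have "first_nonzero_pos (Fin (map u (map f [0..<Suc i])))" .
        with i show ?thesis by (auto simp del: upt_Suc dest!: spec[of _ i])
      qed
      then show ?thesis by simp
    qed
    with fin show "\<forall>p\<in>root_based_paths T. first_nonzero_pos (map_seq u p)"
      unfolding root_based_paths_def by (auto split: seq.splits simp: comp_def elim!: root_based.elims)
  qed
  then show ?thesis unfolding tree_carrier_def by auto
qed

proposition comm_bck_tree_algebra: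
  assumes T: "rooted_tree T"
  shows "comm_bck_algebra (tree_algebra T)"
proof -
  let ?n = "\<lambda>\<alpha>. length (path_to T \<alpha>)" and ?P = "\<lambda>\<alpha> i. path_to T \<alpha> ! i"
  have eqI: "w \<alpha> = w' \<alpha>" if "\<alpha> \<in> verts T" "\<And>i. i < ?n \<alpha> \<Longrightarrow> w (?P \<alpha> i) = w' (?P \<alpha> i)"
    for w w' :: "'a \<Rightarrow> int" and \<alpha>
    using path_to(3)[OF T that(1)] path_to_nonempty[OF T that(1)] that(2)[of "?n \<alpha> - 1"]
    by (simp add: last_conv_nth)
  have out: "tree_op T u v \<alpha> = 0" if "\<alpha> \<notin> verts T" for u v \<alpha>
    using that by (simp add: tree_op_def)
  have pos: "lex_pos (?n \<alpha>) (\<lambda>i. u (?P \<alpha> i)) \<or> (\<forall>i<?n \<alpha>. u (?P \<alpha> i) = 0)"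
    if "u \<in> tree_carrier T" "\<alpha> \<in> verts T" for u \<alpha>
    using that tree_carrier_iff[OF T] by blast
  have op_val: "(lex_pos (?n \<alpha>) (\<lambda>i. u (?P \<alpha> i) - v (?P \<alpha> i)) \<longrightarrow>
        (\<forall>i<?n \<alpha>. tree_op T u v (?P \<alpha> i) = u (?P \<alpha> i) - v (?P \<alpha> i)))
     \<and> (\<not> lex_pos (?n \<alpha>) (\<lambda>i. u (?P \<alpha> i) - v (?P \<alpha> i)) \<longrightarrow>
        (\<forall>i<?n \<alpha>. tree_op T u v (?P \<alpha> i) = 0))"
    if "\<alpha> \<in> verts T" for u v \<alpha>
    using tree_op_along[OF T that, of _ u v] by auto
  have zero: "(\<lambda>_. 0) \<in> tree_carrier T" using tree_carrier_iff[OF T] by simp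
  have closed: "tree_op T u v \<in> tree_carrier T"
    if u: "u \<in> tree_carrier T" and v: "v \<in> tree_carrier T" for u v
  proof -
    have "{\<alpha> \<in> verts T. tree_op T u v \<alpha> \<noteq> 0} \<subseteq> {\<alpha> \<in> verts T. u \<alpha> \<noteq> 0} \<union> {\<alpha> \<in> verts T. v \<alpha> \<noteq> 0}"
      by (auto simp: tree_op_def split: if_splits)
    then have "finite {\<alpha> \<in> verts T. tree_op T u v \<alpha> \<noteq> 0}"
      using u v unfolding tree_carrier_def by (auto elim: finite_subset)
    moreover have "lex_pos (?n \<alpha>) (\<lambda>i. tree_op T u v (?P \<alpha> i)) \<or> (\<forall>i<?n \<alpha>. tree_op T u v (?P \<alpha> i) = 0)"
      if "\<alpha> \<in> verts T" for \<alpha>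
      using op_val[OF that, of u v] lex_pos_cong[of "?n \<alpha>" "\<lambda>i. tree_op T u v (?P \<alpha> i)" "\<lambda>i. u (?P \<alpha> i) - v (?P \<alpha> i)"]
      by blast
    ultimately show ?thesis using out tree_carrier_iff[OF T] by blast
  qed
  have exch: "tree_op T (tree_op T u v) w = tree_op T (tree_op T u w) v"
    if u: "u \<in> tree_carrier T" and v: "v \<in> tree_carrier T" and w: "w \<in> tree_carrier T" for u v w
  proof -
    \<comment> \<open>both sides are the positive part of \<open>u - v - w\<close>\<close>
    have main: "(lex_pos (?n \<alpha>) (\<lambda>i. u (?P \<alpha> i) - v (?P \<alpha> i) - w (?P \<alpha> i)) \<longrightarrow>
        (\<forall>i<?n \<alpha>. tree_op T (tree_op T u v) w (?P \<alpha> i) = u (?P \<alpha> i) - v (?P \<alpha> i) - w (?P \<alpha> i)))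
     \<and> (\<not> lex_pos (?n \<alpha>) (\<lambda>i. u (?P \<alpha> i) - v (?P \<alpha> i) - w (?P \<alpha> i)) \<longrightarrow>
        (\<forall>i<?n \<alpha>. tree_op T (tree_op T u v) w (?P \<alpha> i) = 0))"
      if a: "\<alpha> \<in> verts T" and w: "w \<in> tree_carrier T" for \<alpha> v w
    proof (cases "lex_pos (?n \<alpha>) (\<lambda>i. u (?P \<alpha> i) - v (?P \<alpha> i))")
      case True
      then have 1: "\<forall>i<?n \<alpha>. tree_op T u v (?P \<alpha> i) = u (?P \<alpha> i) - v (?P \<alpha> i)"
        using op_val[OF a] by blast
      have "lex_pos (?n \<alpha>) (\<lambda>i. tree_op T u v (?P \<alpha> i) - w (?P \<alpha> i)) =
        lex_pos (?n \<alpha>) (\<lambda>i. u (?P \<alpha> i) - v (?P \<alpha> i) - w (?P \<alpha> i))"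
        using 1 by (intro lex_pos_cong) auto
      then show ?thesis using op_val[OF a, of "tree_op T u v" w] 1 by auto
    next
      case False
      then have 1: "\<forall>i<?n \<alpha>. tree_op T u v (?P \<alpha> i) = 0"
        using op_val[OF a] by blast
      have "\<not> lex_pos (?n \<alpha>) (\<lambda>i. u (?P \<alpha> i) - v (?P \<alpha> i) - w (?P \<alpha> i))"
        using lex_pos_add[of "?n \<alpha>" "\<lambda>i. u (?P \<alpha> i) - v (?P \<alpha> i) - w (?P \<alpha> i)" "\<lambda>i. w (?P \<alpha> i)"]
          pos[OF w a] False by auto
      moreover have "\<not> lex_pos (?n \<alpha>) (\<lambda>i. tree_op T u v (?P \<alpha> i) - w (?P \<alpha> i))"
      proof
        assume p: "lex_pos (?n \<alpha>) (\<lambda>i. tree_op T u v (?P \<alpha> i) - w (?P \<alpha> i))"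
        from lex_pos_add[OF p pos[OF w a]] 1 show False using lex_pos_zero by auto
      qed
      ultimately show ?thesis using op_val[OF a, of "tree_op T u v" w] by auto
    qed
    have sw: "u x - w x - v x = u x - v x - w x" for x by simp
    show ?thesis
    proof
      fix \<alpha>
      show "tree_op T (tree_op T u v) w \<alpha> = tree_op T (tree_op T u w) v \<alpha>"
      proof (cases "\<alpha> \<in> verts T")
        case True
        show ?thesis
        proof (rule eqI[OF True])
          fix i assume "i < ?n \<alpha>"
          then show "tree_op T (tree_op T u v) w (?P \<alpha> i) = tree_op T (tree_op T u w) v (?P \<alpha> i)"
            using main[OF True w, of v] main[OF True v, of w] unfolding sw by fastforce
        qed
      qed (simp add: out)
    qed
  qed
  have comm: "tree_op T u (tree_op T u v) = tree_op T v (tree_op T v u)"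
    if u: "u \<in> tree_carrier T" and v: "v \<in> tree_carrier T" for u v
  proof -
    \<comment> \<open>both sides are the minimum of \<open>u\<close> and \<open>v\<close>\<close>
    have main: "(lex_pos (?n \<alpha>) (\<lambda>i. u (?P \<alpha> i) - v (?P \<alpha> i)) \<longrightarrow>
        (\<forall>i<?n \<alpha>. tree_op T u (tree_op T u v) (?P \<alpha> i) = v (?P \<alpha> i)))
     \<and> (\<not> lex_pos (?n \<alpha>) (\<lambda>i. u (?P \<alpha> i) - v (?P \<alpha> i)) \<longrightarrow>
        (\<forall>i<?n \<alpha>. tree_op T u (tree_op T u v) (?P \<alpha> i) = u (?P \<alpha> i)))"
      if a: "\<alpha> \<in> verts T" and u: "u \<in> tree_carrier T" and v: "v \<in> tree_carrier T" for \<alpha> u v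
    proof (cases "lex_pos (?n \<alpha>) (\<lambda>i. u (?P \<alpha> i) - v (?P \<alpha> i))")
      case True
      then have 1: "\<forall>i<?n \<alpha>. tree_op T u v (?P \<alpha> i) = u (?P \<alpha> i) - v (?P \<alpha> i)"
        using op_val[OF a] by blast
      have "lex_pos (?n \<alpha>) (\<lambda>i. u (?P \<alpha> i) - tree_op T u v (?P \<alpha> i)) = lex_pos (?n \<alpha>) (\<lambda>i. v (?P \<alpha> i))"
        using 1 by (intro lex_pos_cong) auto
      then show ?thesis using op_val[OF a, of u "tree_op T u v"] 1 True pos[OF v a] by auto
    next
      case False
      then have 1: "\<forall>i<?n \<alpha>. tree_op T u v (?P \<alpha> i) = 0"
        using op_val[OF a] by blast
      have "lex_pos (?n \<alpha>) (\<lambda>i. u (?P \<alpha> i) - tree_op T u v (?P \<alpha> i)) = lex_pos (?n \<alpha>) (\<lambda>i. u (?P \<alpha> i))"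
        using 1 by (intro lex_pos_cong) auto
      then show ?thesis using op_val[OF a, of u "tree_op T u v"] 1 False pos[OF u a] by auto
    qed
    show ?thesis
    proof
      fix \<alpha>
      show "tree_op T u (tree_op T u v) \<alpha> = tree_op T v (tree_op T v u) \<alpha>"
      proof (cases "\<alpha> \<in> verts T")
        case True
        have tri: "lex_pos (?n \<alpha>) (\<lambda>i. u (?P \<alpha> i) - v (?P \<alpha> i)) \<or> lex_pos (?n \<alpha>) (\<lambda>i. v (?P \<alpha> i) - u (?P \<alpha> i))
          \<or> (\<forall>i<?n \<alpha>. u (?P \<alpha> i) = v (?P \<alpha> i))"
          using lex_pos_trichotomy[of "?n \<alpha>" "\<lambda>i. u (?P \<alpha> i) - v (?P \<alpha> i)"] by auto
        have asym: "\<not> (lex_pos (?n \<alpha>) (\<lambda>i. u (?P \<alpha> i) - v (?P \<alpha> i)) \<and> lex_pos (?n \<alpha>) (\<lambda>i. v (?P \<alpha> i) - u (?P \<alpha> i)))"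
          using lex_pos_add[of "?n \<alpha>" "\<lambda>i. u (?P \<alpha> i) - v (?P \<alpha> i)" "\<lambda>i. v (?P \<alpha> i) - u (?P \<alpha> i)"]
            lex_pos_zero[of "?n \<alpha>" "\<lambda>_. 0"] by auto
        show ?thesis
        proof (rule eqI[OF True])
          fix i assume i: "i < ?n \<alpha>"
          have val: "tree_op T u (tree_op T u v) (?P \<alpha> i) =
              (if lex_pos (?n \<alpha>) (\<lambda>i. u (?P \<alpha> i) - v (?P \<alpha> i)) then v (?P \<alpha> i) else u (?P \<alpha> i))"
            if "u \<in> tree_carrier T" "v \<in> tree_carrier T" for u v
            using main[OF True that] i by presburger
          show "tree_op T u (tree_op T u v) (?P \<alpha> i) = tree_op T v (tree_op T v u) (?P \<alpha> i)"
            unfolding val[OF u v] val[OF v u] using tri asym i by presburger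
        qed
      qed (simp add: out)
    qed
  qed
  have self: "tree_op T u u = (\<lambda>_. 0)" for u
    by (auto simp: tree_op_def lex_less_map_iff lex_pos_def)
  have unit: "tree_op T u (\<lambda>_. 0) = u" if u: "u \<in> tree_carrier T" for u
  proof
    fix \<alpha>
    show "tree_op T u (\<lambda>_. 0) \<alpha> = u \<alpha>"
    proof (cases "\<alpha> \<in> verts T")
      case True
      show ?thesis
      proof (rule eqI[OF True])
        fix i assume "i < ?n \<alpha>"
        then show "tree_op T u (\<lambda>_. 0) (?P \<alpha> i) = u (?P \<alpha> i)"
          using op_val[OF True, of u "\<lambda>_. 0"] pos[OF u True] by auto
      qed
    next
      case False
      then show ?thesis using u by (simp add: out tree_carrier_def)
    qed
  qed
  show ?thesis
    unfolding comm_bck_algebra_def tree_algebra_def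
    using zero closed exch comm self unit by simp
qed

end

theory Submission
  imports Defs
begin

text \<open>Only \<open>I(\<P>(J)) \<subseteq> J\<close> needs an argument.  Pointwise addition keeps the carrier closed, and
  \<open>(u + v) \<cdot> v = u\<close>; hence an ideal, although it is defined through truncated subtraction, is
  closed under addition (\<open>tree_ideal_add\<close>).  It is also downward closed, because
  \<open>u \<cdot> w = 0\<close> when \<open>u\<close> is lexicographically at most \<open>w\<close> along every path.  So it suffices to
  find \<open>w \<in> J\<close> above a given \<open>u \<in> I(\<P>(J))\<close>.

  For each of the finitely many vertices \<open>\<beta>\<close> with \<open>u\<^sub>\<beta> \<noteq> 0\<close> the path \<open>[\<lambda>,\<beta>]\<close> is not in
  \<open>\<P>(J)\<close>, so some \<open>v\<^sub>\<beta> \<in> J\<close> does not vanish on \<open>[\<lambda>,\<beta>]\<close>.  Let \<open>w\<close> be the sum of the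
  \<open>(|u\<^sub>\<beta>| + 1) v\<^sub>\<beta>\<close>.  Along a path on which \<open>u\<close> is not zero, let \<open>\<beta>\<close> be the vertex where \<open>u\<close>
  first becomes non-zero.  There \<open>v\<^sub>\<beta>\<close> has become non-zero at \<open>\<beta>\<close> or before it, and so the summand
  \<open>(|u\<^sub>\<beta>| + 1) v\<^sub>\<beta>\<close> alone exceeds \<open>u\<close> lexicographically (\<open>lex_pos_scaled_diff\<close>); the other
  summands, being in the carrier, cannot spoil this.\<close>

lemma tree_carrier_lex:
  assumes "rooted_tree T" "u \<in> tree_carrier T" "\<alpha> \<in> verts T"
  shows "lex_pos (length (path_to T \<alpha>)) (\<lambda>i. u (path_to T \<alpha> ! i))
    \<or> (\<forall>i<length (path_to T \<alpha>). u (path_to T \<alpha> ! i) = 0)"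
  using assms tree_carrier_iff[OF assms(1)] by blast

lemma tree_carrier_add:
  assumes T: "rooted_tree T" and u: "u \<in> tree_carrier T" and v: "v \<in> tree_carrier T"
  shows "(\<lambda>x. u x + v x) \<in> tree_carrier T"
proof -
  have "{\<alpha> \<in> verts T. u \<alpha> + v \<alpha> \<noteq> 0} \<subseteq> {\<alpha> \<in> verts T. u \<alpha> \<noteq> 0} \<union> {\<alpha> \<in> verts T. v \<alpha> \<noteq> 0}"
    by auto
  then have "finite {\<alpha> \<in> verts T. u \<alpha> + v \<alpha> \<noteq> 0}"
    using u v unfolding tree_carrier_def by (auto elim: finite_subset)
  moreover have "lex_pos (length (path_to T \<alpha>)) (\<lambda>i. u (path_to T \<alpha> ! i) + v (path_to T \<alpha> ! i))
      \<or> (\<forall>i<length (path_to T \<alpha>). u (path_to T \<alpha> ! i) + v (path_to T \<alpha> ! i) = 0)"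
    if a: "\<alpha> \<in> verts T" for \<alpha>
  proof (cases "lex_pos (length (path_to T \<alpha>)) (\<lambda>i. u (path_to T \<alpha> ! i))")
    case True
    then show ?thesis using lex_pos_add[OF True tree_carrier_lex[OF T v a]] by blast
  next
    case False
    then have z: "\<forall>i<length (path_to T \<alpha>). u (path_to T \<alpha> ! i) = 0"
      using tree_carrier_lex[OF T u a] by blast
    then have "lex_pos (length (path_to T \<alpha>)) (\<lambda>i. u (path_to T \<alpha> ! i) + v (path_to T \<alpha> ! i))
        = lex_pos (length (path_to T \<alpha>)) (\<lambda>i. v (path_to T \<alpha> ! i))"
      by (intro lex_pos_cong) simp
    then show ?thesis using tree_carrier_lex[OF T v a] z by auto
  qed
  ultimately show ?thesis
    using u v unfolding tree_carrier_iff[OF T] by auto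
qed

lemma tree_op_add_cancel:
  assumes T: "rooted_tree T" and u: "u \<in> tree_carrier T"
  shows "tree_op T (\<lambda>x. u x + v x) v = u"
proof
  fix \<alpha>
  show "tree_op T (\<lambda>x. u x + v x) v \<alpha> = u \<alpha>"
  proof (cases "\<alpha> \<in> verts T")
    case True
    have "u \<alpha> = 0" if "\<forall>i<length (path_to T \<alpha>). u (path_to T \<alpha> ! i) = 0"
      using that[rule_format, of "length (path_to T \<alpha>) - 1"] path_to(3)[OF T True]
        path_to_nonempty[OF T True] by (simp add: last_conv_nth)
    then show ?thesis
      using True tree_carrier_lex[OF T u True] by (auto simp: tree_op_def lex_less_map_iff)
  next
    case False
    then show ?thesis using u by (simp add: tree_op_def tree_carrier_def)
  qed
qed

lemma tree_ideal_subset: "bck_ideal (tree_algebra T) J \<Longrightarrow> J \<subseteq> tree_carrier T"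
  by (simp add: bck_ideal_def tree_algebra_def)

lemma tree_ideal_zero: "bck_ideal (tree_algebra T) J \<Longrightarrow> (\<lambda>_. 0) \<in> J"
  by (simp add: bck_ideal_def tree_algebra_def)

lemma tree_ideal_cancel:
  assumes "bck_ideal (tree_algebra T) J" "u \<in> tree_carrier T" "tree_op T u v \<in> J" "v \<in> J"
  shows "u \<in> J"
  using assms by (auto simp: bck_ideal_def tree_algebra_def)

text \<open>The sum is recovered from \<open>(u + v) \<cdot> v = u \<in> J\<close> and \<open>v \<in> J\<close>.\<close>

lemma tree_ideal_add:
  assumes T: "rooted_tree T" and J: "bck_ideal (tree_algebra T) J" and u: "u \<in> J" and v: "v \<in> J"
  shows "(\<lambda>x. u x + v x) \<in> J"
proof (rule tree_ideal_cancel[OF J _ _ v])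
  have "u \<in> tree_carrier T" "v \<in> tree_carrier T"
    using tree_ideal_subset[OF J] u v by auto
  then show "(\<lambda>x. u x + v x) \<in> tree_carrier T" "tree_op T (\<lambda>x. u x + v x) v \<in> J"
    using tree_carrier_add[OF T] tree_op_add_cancel[OF T] u by auto
qed

lemma tree_ideal_sum:
  assumes T: "rooted_tree T" and J: "bck_ideal (tree_algebra T) J"
    and "finite S" "\<And>s. s \<in> S \<Longrightarrow> v s \<in> J"
  shows "(\<lambda>x. \<Sum>s\<in>S. v s x) \<in> J"
  using assms(3,4)
proof (induction S rule: finite_induct)
  case empty
  then show ?case using tree_ideal_zero[OF J] by simp
next
  case (insert s S)
  then show ?case using tree_ideal_add[OF T J, of "v s"] by simp
qed

lemma tree_ideal_scale:
  assumes T: "rooted_tree T" and J: "bck_ideal (tree_algebra T) J" and v: "v \<in> J"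
    and c: "c \<ge> 0"
  shows "(\<lambda>x. c * v x) \<in> J"
  using tree_ideal_sum[OF T J, of "{..<nat c}" "\<lambda>_. v"] v c by simp

lemma tree_ideal_downward_closed:
  assumes J: "bck_ideal (tree_algebra T) J" and w: "w \<in> J" and u: "u \<in> tree_carrier T"
    and le: "\<And>\<alpha>. \<alpha> \<in> verts T \<Longrightarrow>
      \<not> lex_pos (length (path_to T \<alpha>)) (\<lambda>i. u (path_to T \<alpha> ! i) - w (path_to T \<alpha> ! i))"
  shows "u \<in> J"
proof -
  have "tree_op T u w = (\<lambda>_. 0)"
  proof
    fix \<alpha>
    show "tree_op T u w \<alpha> = 0"
      using le[of \<alpha>] by (cases "\<alpha> \<in> verts T") (simp_all add: tree_op_def lex_less_map_iff)
  qed
  then show ?thesis using tree_ideal_cancel[OF J u _ w] tree_ideal_zero[OF J] by simp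
qed

lemma lex_pos_antisym:
  assumes "lex_pos n (\<lambda>i. f i - g i)"
  shows "\<not> lex_pos n (\<lambda>i. g i - f i)"
proof
  assume "lex_pos n (\<lambda>i. g i - f i)"
  from lex_pos_add[OF assms disjI1[OF this]] show False by (auto simp: lex_pos_def)
qed

text \<open>If \<open>g\<close> becomes non-zero strictly before index \<open>k\<close>, any positive multiple of it wins over
  \<open>f\<close>; the size of \<open>c\<close> matters only when both have their first non-zero entry at \<open>k\<close>.\<close>

lemma lex_pos_scaled_diff:
  fixes c :: int
  assumes k: "k < n" "f k > 0" "\<forall>j<k. f j = 0" and g: "lex_pos (Suc k) g" and c: "c > f k"
  shows "lex_pos n (\<lambda>i. c * g i - f i)"
proof -
  from g obtain l where l: "l \<le> k" "g l > 0" "\<forall>j<l. g j = 0"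
    by (auto simp: lex_pos_def less_Suc_eq_le)
  have "c * 1 \<le> c * g l" using l c k by (intro mult_left_mono) auto
  moreover have "f l \<le> f k" using l k by (cases "l = k") auto
  ultimately have "c * g l - f l > 0" using c by simp
  with l k show ?thesis unfolding lex_pos_def by (intro exI[of _ l]) auto
qed

text \<open>Otherwise \<open>[\<lambda>,\<beta>]\<close> would itself be one of the paths on which \<open>u\<close> is required to vanish.\<close>

lemma vanishing_on_zero_paths_nonzero:
  assumes T: "rooted_tree T" and u: "u \<in> vanishing_on T (zero_paths T J)"
    and b: "\<beta> \<in> verts T" "u \<beta> \<noteq> 0"
  shows "\<exists>v\<in>J. \<exists>x\<in>set (path_to T \<beta>). v x \<noteq> 0"
proof (rule ccontr)
  assume "\<not> ?thesis"
  then have "Fin (path_to T \<beta>) \<in> zero_paths T J"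
    using root_based_path_to[OF T b(1)]
    by (auto simp: zero_paths_def root_based_paths_def)
  with u have "map u (path_to T \<beta>) = map (\<lambda>_. 0) (path_to T \<beta>)"
    by (fastforce simp: vanishing_on_def)
  then have "\<forall>x\<in>set (path_to T \<beta>). u x = 0" by (simp only: map_eq_conv)
  moreover have "\<beta> \<in> set (path_to T \<beta>)"
    using path_to(3)[OF T b(1)] path_to_nonempty[OF T b(1)] last_in_set by metis
  ultimately show False using b(2) by blast
qed

theorem theorem3p9:
  fixes T :: "'v rooted_graph" and J :: "('v \<Rightarrow> int) set"
  assumes "rooted_tree T"
    and "bck_ideal (tree_algebra T) J"
  shows "J = vanishing_on T (zero_paths T J)
    \<and> (\<exists>R. R \<subseteq> root_based_paths T \<and> J = vanishing_on T R)"
proof -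
  note T = assms(1) and J = assms(2)
  have "J \<subseteq> vanishing_on T (zero_paths T J)"
    using tree_ideal_subset[OF J] by (auto simp: vanishing_on_def zero_paths_def tree_algebra_def)
  moreover have "u \<in> J" if u: "u \<in> vanishing_on T (zero_paths T J)" for u
  proof -
    have uc: "u \<in> tree_carrier T" using u by (simp add: vanishing_on_def tree_algebra_def)
    define S where "S = {\<beta> \<in> verts T. u \<beta> \<noteq> 0}"
    have S: "finite S" using uc by (simp add: S_def tree_carrier_def)
    obtain v where v: "\<And>\<beta>. \<beta> \<in> S \<Longrightarrow> v \<beta> \<in> J"
        "\<And>\<beta>. \<beta> \<in> S \<Longrightarrow> \<exists>x\<in>set (path_to T \<beta>). v \<beta> x \<noteq> 0"
      using vanishing_on_zero_paths_nonzero[OF T u] unfolding S_def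
      by (metis (mono_tags, lifting) mem_Collect_eq)
    \<comment> \<open>\<open>S\<close> also contains vertices below the first non-zero ones, where \<open>u\<close> may be negative; the
      absolute value keeps the multiple in the ideal there.\<close>
    define t where "t \<beta> x = (\<bar>u \<beta>\<bar> + 1) * v \<beta> x" for \<beta> x
    define w where "w x = (\<Sum>\<beta>\<in>S. t \<beta> x)" for x
    have t: "t \<beta> \<in> J" if "\<beta> \<in> S" for \<beta>
      unfolding t_def using tree_ideal_scale[OF T J v(1)[OF that]] by simp
    have w: "w \<in> J" unfolding w_def using tree_ideal_sum[OF T J S t] by simp
    show ?thesis
    proof (rule tree_ideal_downward_closed[OF J w uc])
      fix \<alpha> assume a: "\<alpha> \<in> verts T"
      let ?P = "path_to T \<alpha>"
      let ?n = "length ?P"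
      from tree_carrier_lex[OF T uc a]
      show "\<not> lex_pos ?n (\<lambda>i. u (?P ! i) - w (?P ! i))"
      proof
        assume "\<forall>i<?n. u (?P ! i) = 0"
        then have eq: "lex_pos ?n (\<lambda>i. u (?P ! i) - w (?P ! i)) = lex_pos ?n (\<lambda>i. 0 - w (?P ! i))"
          by (intro lex_pos_cong) simp
        have "w \<in> tree_carrier T" using w tree_ideal_subset[OF J] by blast
        from tree_carrier_lex[OF T this a]
        show ?thesis unfolding eq
          using lex_pos_antisym[of ?n "\<lambda>i. w (?P ! i)" "\<lambda>_. 0"] by (auto simp: lex_pos_def)
      next
        assume "lex_pos ?n (\<lambda>i. u (?P ! i))"
        then obtain k where k: "k < ?n" "u (?P ! k) > 0" "\<forall>j<k. u (?P ! j) = 0"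
          by (auto simp: lex_pos_def)
        define \<beta> where "\<beta> = ?P ! k"
        have b: "path_to T \<beta> = take (Suc k) ?P" "\<beta> \<in> verts T"
          using path_to_nth[OF T a k(1)] by (auto simp: \<beta>_def)
        have bS: "\<beta> \<in> S" using b(2) k(2) by (simp add: S_def \<beta>_def)
        have len: "length (path_to T \<beta>) = Suc k" using b(1) k(1) by simp
        have "v \<beta> \<in> tree_carrier T" using v(1)[OF bS] tree_ideal_subset[OF J] by blast
        from tree_carrier_lex[OF T this b(2)]
        have "lex_pos (Suc k) (\<lambda>i. v \<beta> (path_to T \<beta> ! i))"
          using v(2)[OF bS] unfolding len by (metis in_set_conv_nth len)
        then have "lex_pos (Suc k) (\<lambda>i. v \<beta> (?P ! i))"
          unfolding b(1) by (subst lex_pos_cong) auto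
        then have "lex_pos ?n (\<lambda>i. (\<bar>u \<beta>\<bar> + 1) * v \<beta> (?P ! i) - u (?P ! i))"
          using k by (intro lex_pos_scaled_diff[where k = k]) (auto simp: \<beta>_def)
        then have main: "lex_pos ?n (\<lambda>i. t \<beta> (?P ! i) - u (?P ! i))"
          by (simp add: t_def)
        define r where "r x = (\<Sum>\<gamma>\<in>S - {\<beta>}. t \<gamma> x)" for x
        have "r \<in> J" unfolding r_def using S t by (intro tree_ideal_sum[OF T J]) auto
        then have "r \<in> tree_carrier T" using tree_ideal_subset[OF J] by blast
        from lex_pos_add[OF main tree_carrier_lex[OF T this a]]
        have "lex_pos ?n (\<lambda>i. t \<beta> (?P ! i) - u (?P ! i) + r (?P ! i))" .
        moreover have "t \<beta> x - u x + r x = w x - u x" for x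
          unfolding w_def r_def using S bS by (simp add: sum.remove)
        ultimately show ?thesis using lex_pos_antisym by simp
      qed
    qed
  qed
  ultimately have eq: "J = vanishing_on T (zero_paths T J)" by blast
  moreover have "zero_paths T J \<subseteq> root_based_paths T" by (auto simp: zero_paths_def)
  ultimately show ?thesis by blast
qed

end
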